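(* Let $A$ be either $\Bbbk_q[u,v]$ with $q\in\Bbbk^\times$, $q\ne1$, and $G=\frac1n(1,a)$ with $1\le a<n$, $\gcd(a,n)=1$; or $A=\Bbbk_J[u,v]$ and $G=\frac1n(1,1)$ with $n\ge2$. Let $\overline g=\sum_{g\in G}g\in A\# G$. Then $(A\# G)/\langle\overline g\rangle$ is finite dimensional over $\Bbbk$; consequently the Auslander map $\phi:A\#G\to\mathrm{End}_{A^G}(A)$, $\phi(ag)(b)=a(g\cdot b)$, is an isomorphism.
   Context: $\Bbbk$ is algebraically closed of characteristic $0$; $\omega_n$ is a primitive $n$th root of unity. $\Bbbk_q[u,v]=\Bbbk\langle u,v\rangle/(vu-quv)$, $\Bbbk_J[u,v]=\Bbbk\langle u,v\rangle/(vu-uv-u^2)$. A matrix $\begin{pmatrix}a&b\\c&d\end{pmatrix}$ acts by $u\mapsto au+cv$, $v\mapsto bu+dv$; $\frac1n(1,a)$ is the cyclic group generated by $\mathrm{diag}(\omega_n,\omega_n^a)$. $A\#G$ is the skew group (smash product) algebra $A\otimes\Bbbk G$ with multiplication $(ag)(bh)=a(g\cdot b)gh$; $\langle\overline g\rangle$ is the two-sided ideal generated by $\overline g$; $A^G$ is the invariant ring. *)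

theory Defs
  imports "HOL-Computational_Algebra.Polynomial"
begin

definition algebraically_closed_field :: "'k::field itself \<Rightarrow> bool" where
  "algebraically_closed_field _ \<longleftrightarrow>
     (\<forall>p::'k poly. degree p > 0 \<longrightarrow> (\<exists>x. poly p x = 0))"

text \<open>Free algebra k<u,v>: words over {u,v} are bool lists (False = u, True = v);
  elements are finitely supported coefficient functions on words, the product
  is concatenation of words (convolution).\<close>
type_synonym word = "bool list"

definition FA :: "(word \<Rightarrow> 'k::field) set" where
  "FA = {f. finite {w. f w \<noteq> 0}}"

definition fa_mult :: "(word \<Rightarrow> 'k::field) \<Rightarrow> (word \<Rightarrow> 'k) \<Rightarrow> (word \<Rightarrow> 'k)" where
  "fa_mult f g = (\<lambda>w. \<Sum>i\<le>length w. f (take i w) * g (drop i w))"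

definition qrel :: "'k::field \<Rightarrow> (word \<Rightarrow> 'k)" where
  "qrel q = (\<lambda>w. if w = [True, False] then 1 else if w = [False, True] then - q else 0)"

definition jrel :: "word \<Rightarrow> 'k::field" where
  "jrel = (\<lambda>w. if w = [True, False] then 1 else if w = [False, True] then -1
               else if w = [False, False] then -1 else 0)"

inductive_set ideal_gen ::
  "('x \<Rightarrow> 'k::field) set \<Rightarrow> (('x \<Rightarrow> 'k) \<Rightarrow> ('x \<Rightarrow> 'k) \<Rightarrow> ('x \<Rightarrow> 'k)) \<Rightarrow> ('x \<Rightarrow> 'k) set
   \<Rightarrow> ('x \<Rightarrow> 'k) set"
  for C mult S where
  gen: "s \<in> S \<Longrightarrow> s \<in> ideal_gen C mult S"
| zero: "(\<lambda>_. 0) \<in> ideal_gen C mult S"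
| add: "a \<in> ideal_gen C mult S \<Longrightarrow> b \<in> ideal_gen C mult S \<Longrightarrow> (\<lambda>x. a x + b x) \<in> ideal_gen C mult S"
| smult: "a \<in> ideal_gen C mult S \<Longrightarrow> (\<lambda>x. c * a x) \<in> ideal_gen C mult S"
| lmult: "c \<in> C \<Longrightarrow> a \<in> ideal_gen C mult S \<Longrightarrow> mult c a \<in> ideal_gen C mult S"
| rmult: "c \<in> C \<Longrightarrow> a \<in> ideal_gen C mult S \<Longrightarrow> mult a c \<in> ideal_gen C mult S"

text \<open>The ideal I = (rel) of k<u,v>; A = k<u,v>/I.\<close>
definition I_rel :: "(word \<Rightarrow> 'k::field) \<Rightarrow> (word \<Rightarrow> 'k) set" where
  "I_rel rel = ideal_gen FA fa_mult {rel}"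

definition fin_dim_quot :: "('x \<Rightarrow> 'k::field) set \<Rightarrow> ('x \<Rightarrow> 'k) set \<Rightarrow> bool" where
  "fin_dim_quot C I \<longleftrightarrow> (\<exists>B. finite B \<and> B \<subseteq> C \<and>
      (\<forall>x\<in>C. \<exists>c. (\<lambda>y. x y - (\<Sum>b\<in>B. c b * b y)) \<in> I))"

text \<open>G = 1/n(1,a) generated by g = diag(w, w^a): g^k acts on a word with
  #u = i, #v = j by the scalar w^(k(i + a j)).  (For the Jordan case a = 1.)\<close>
definition weight :: "nat \<Rightarrow> word \<Rightarrow> nat" where
  "weight a w = length (filter Not w) + a * length (filter id w)"

definition act :: "'k::field \<Rightarrow> nat \<Rightarrow> nat \<Rightarrow> (word \<Rightarrow> 'k) \<Rightarrow> (word \<Rightarrow> 'k)" where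
  "act \<omega> a k b = (\<lambda>w. \<omega> ^ (k * weight a w) * b w)"

text \<open>Skew group algebra k<u,v> # G: the element with coefficient f(k,w) at w g^k.
  Product (w1 g^k1)(w2 g^k2) = w1 (g^k1 . w2) g^(k1+k2).\<close>
definition SG :: "nat \<Rightarrow> (nat \<times> word \<Rightarrow> 'k::field) set" where
  "SG n = {f. finite {p. f p \<noteq> 0} \<and> (\<forall>k w. f (k, w) \<noteq> 0 \<longrightarrow> k < n)}"

definition sg_mult :: "nat \<Rightarrow> 'k::field \<Rightarrow> nat \<Rightarrow>
    (nat \<times> word \<Rightarrow> 'k) \<Rightarrow> (nat \<times> word \<Rightarrow> 'k) \<Rightarrow> (nat \<times> word \<Rightarrow> 'k)" where
  "sg_mult n \<omega> a f h = (\<lambda>(k, w). \<Sum>k1<n. \<Sum>k2<n.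
      if (k1 + k2) mod n = k then
        (\<Sum>i\<le>length w. f (k1, take i w) * \<omega> ^ (k1 * weight a (drop i w)) * h (k2, drop i w))
      else 0)"

definition sg_one :: "nat \<times> word \<Rightarrow> 'k::field" where
  "sg_one = (\<lambda>(k, w). if k = 0 \<and> w = [] then 1 else 0)"

text \<open>Kernel of k<u,v> # G \<rightarrow> A # G, namely I # G; so A # G = SG / skew_ker.\<close>
definition skew_ker :: "nat \<Rightarrow> (word \<Rightarrow> 'k::field) \<Rightarrow> (nat \<times> word \<Rightarrow> 'k) set" where
  "skew_ker n rel = {x \<in> SG n. \<forall>k. (\<lambda>w. x (k, w)) \<in> I_rel rel}"

definition gbar :: "nat \<Rightarrow> nat \<times> word \<Rightarrow> 'k::field" where
  "gbar n = (\<lambda>(k, w). if k < n \<and> w = [] then 1 else 0)"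

text \<open>Preimage in k<u,v> # G of the two-sided ideal <gbar> of A # G.\<close>
definition gbar_ideal :: "nat \<Rightarrow> 'k::field \<Rightarrow> nat \<Rightarrow> (word \<Rightarrow> 'k) \<Rightarrow> (nat \<times> word \<Rightarrow> 'k) set" where
  "gbar_ideal n \<omega> a rel = ideal_gen (SG n) (sg_mult n \<omega> a) (skew_ker n rel \<union> {gbar n})"

text \<open>Auslander map: phi(b g^k)(c) = b (g^k . c), on representatives.\<close>
definition auslander :: "nat \<Rightarrow> 'k::field \<Rightarrow> nat \<Rightarrow> (nat \<times> word \<Rightarrow> 'k) \<Rightarrow> (word \<Rightarrow> 'k) \<Rightarrow> (word \<Rightarrow> 'k)" where
  "auslander n \<omega> a x b = (\<lambda>w. \<Sum>k<n. \<Sum>i\<le>length w.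
      x (k, take i w) * \<omega> ^ (k * weight a (drop i w)) * b (drop i w))"

definition inv_ring :: "nat \<Rightarrow> 'k::field \<Rightarrow> nat \<Rightarrow> (word \<Rightarrow> 'k) \<Rightarrow> (word \<Rightarrow> 'k) set" where
  "inv_ring n \<omega> a rel = {c \<in> FA. \<forall>k<n. (\<lambda>w. act \<omega> a k c w - c w) \<in> I_rel rel}"

text \<open>E (on representatives) induces a well-defined endomorphism of A as a right
  A^G-module, i.e. an element of End_{A^G}(A).\<close>
definition is_End :: "nat \<Rightarrow> 'k::field \<Rightarrow> nat \<Rightarrow> (word \<Rightarrow> 'k) \<Rightarrow> ((word \<Rightarrow> 'k) \<Rightarrow> (word \<Rightarrow> 'k)) \<Rightarrow> bool" where
  "is_End n \<omega> a rel E \<longleftrightarrow>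
     (\<forall>b\<in>FA. E b \<in> FA) \<and>
     (\<forall>b\<in>FA. \<forall>b'\<in>FA. (\<lambda>w. b w - b' w) \<in> I_rel rel \<longrightarrow> (\<lambda>w. E b w - E b' w) \<in> I_rel rel) \<and>
     (\<forall>b\<in>FA. \<forall>b'\<in>FA. (\<lambda>w. E (\<lambda>y. b y + b' y) w - E b w - E b' w) \<in> I_rel rel) \<and>
     (\<forall>b\<in>FA. \<forall>c\<in>inv_ring n \<omega> a rel.
        (\<lambda>w. E (fa_mult b c) w - fa_mult (E b) c w) \<in> I_rel rel)"

definition auslander_iso :: "nat \<Rightarrow> 'k::field \<Rightarrow> nat \<Rightarrow> (word \<Rightarrow> 'k) \<Rightarrow> bool" where
  "auslander_iso n \<omega> a rel \<longleftrightarrow>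
     \<comment> \<open>maps into End_{A^G}(A)\<close>
     (\<forall>x\<in>SG n. is_End n \<omega> a rel (auslander n \<omega> a x)) \<and>
     \<comment> \<open>well defined on A # G\<close>
     (\<forall>x\<in>SG n. \<forall>y\<in>SG n. (\<lambda>p. x p - y p) \<in> skew_ker n rel \<longrightarrow>
        (\<forall>b\<in>FA. (\<lambda>w. auslander n \<omega> a x b w - auslander n \<omega> a y b w) \<in> I_rel rel)) \<and>
     \<comment> \<open>unital and multiplicative\<close>
     (\<forall>b\<in>FA. (\<lambda>w. auslander n \<omega> a sg_one b w - b w) \<in> I_rel rel) \<and>
     (\<forall>x\<in>SG n. \<forall>y\<in>SG n. \<forall>b\<in>FA.
        (\<lambda>w. auslander n \<omega> a (sg_mult n \<omega> a x y) b w
              - auslander n \<omega> a x (auslander n \<omega> a y b) w) \<in> I_rel rel) \<and>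
     \<comment> \<open>injective\<close>
     (\<forall>x\<in>SG n. (\<forall>b\<in>FA. auslander n \<omega> a x b \<in> I_rel rel) \<longrightarrow> x \<in> skew_ker n rel) \<and>
     \<comment> \<open>surjective\<close>
     (\<forall>E. is_End n \<omega> a rel E \<longrightarrow>
        (\<exists>x\<in>SG n. \<forall>b\<in>FA. (\<lambda>w. auslander n \<omega> a x b w - E b w) \<in> I_rel rel))"

end

theory Submission
  imports Defs "HOL-Library.Poly_Mapping" "HOL-Number_Theory.Cong"
begin

text \<open>Both algebras are \<open>A = k\<langle>u,v\<rangle>/(vu - q uv - \<lambda> u\<^sup>2)\<close> with \<open>\<lambda> = 0\<close> or \<open>q = 1\<close>; they have the basis
  \<open>v\<^sup>j u\<^sup>i\<close>, the element \<open>u\<close> is normal and regular, and \<open>A/(u) = k[v]\<close> is a domain. Grade \<open>A\<close> by the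
  characters of \<open>G\<close>. If \<open>y\<close> has weight \<open>j\<close>, then \<open>x \<cdot> gbar \<cdot> y = x y \<Sum>\<^sub>k \<omega>\<^sup>k\<^sup>j g\<^sup>k\<close>. Taking
  \<open>x = z\<^sup>n\<^sup>-\<^sup>j\<close> and \<open>y = z\<^sup>j\<close> for \<open>z = u\<close> or \<open>z = v\<close> and summing over \<open>j\<close> puts \<open>n u\<^sup>n\<close> and \<open>n v\<^sup>n\<close> into
  \<open>\<langle>gbar\<rangle>\<close>, hence all \<open>v\<^sup>j u\<^sup>i\<close> with \<open>i \<ge> n\<close> or \<open>j \<ge> n\<close>.

  For an endomorphism \<open>E\<close> of \<open>A\<close> over the invariants, let \<open>u\<^sup>j\<close> and \<open>v\<^sup>p\<close> have the same weight. Comparing the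
  values of \<open>E\<close> on \<open>v\<^sup>p u\<^sup>n = u\<^sup>n s\<^sup>p\<close>, where \<open>s\<close> is the conjugate of \<open>v\<close> by \<open>u\<^sup>n\<close>, shows that \<open>E(u\<^sup>j)\<close> times a
  power of a conjugate of \<open>v\<close> lies in \<open>A u\<^sup>j\<close>. As \<open>A/(u)\<close> is a domain, \<open>E(u\<^sup>j) = c u\<^sup>j\<close>, and then \<open>E\<close> is
  left multiplication by \<open>c\<close> on all elements of that weight. Fourier inversion over \<open>G\<close> gives the
  preimage of \<open>E\<close>, and also injectivity.\<close>

subsection \<open>The free algebra as a monoid algebra\<close>

text \<open>The product of \<open>Poly_Mapping\<close> is convolution over an additive monoid, so
  reading concatenation as \<open>+\<close> turns \<open>'k free_alg\<close> into the free algebra,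
  with its ring structure.\<close>

instantiation list :: (type) monoid_add
begin

definition zero_list :: "'a list" where "0 = []"
definition plus_list :: "'a list \<Rightarrow> 'a list \<Rightarrow> 'a list" where "xs + ys = xs @ ys"

instance by standard (simp_all add: zero_list_def plus_list_def)

end

type_synonym 'k free_alg = "word \<Rightarrow>\<^sub>0 'k"

abbreviation lk :: "'k::zero free_alg \<Rightarrow> word \<Rightarrow> 'k" where "lk \<equiv> Poly_Mapping.lookup"
abbreviation mon :: "word \<Rightarrow> 'k::zero \<Rightarrow> 'k free_alg" where "mon \<equiv> Poly_Mapping.single"

definition cst :: "'k::field \<Rightarrow> 'k free_alg" where "cst c = mon [] c"
definition U :: "'k::field free_alg" where "U = mon [False] 1"
definition V :: "'k::field free_alg" where "V = mon [True] 1"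

lemma mon_mult: "mon w c * mon w' d = mon (w @ w') (c * d :: 'k::field)"
  by (simp add: mult_single plus_list_def)

lemma cst_0 [simp]: "cst 0 = 0" and cst_1 [simp]: "cst 1 = 1"
  by (simp_all add: cst_def flip: zero_list_def)

lemma cst_add: "cst (c + d) = cst c + cst d"
  and cst_minus: "cst (- c) = - cst c"
  and cst_mult: "cst (c * d) = cst c * cst d"
  by (simp_all add: cst_def single_add single_uminus mon_mult)

lemma cst_sum: "cst (sum f A) = (\<Sum>x\<in>A. cst (f x))"
  by (induction A rule: infinite_finite_induct) (simp_all add: cst_add)

lemma free_alg_induct [case_names mon add]:
  fixes f :: "'k::field free_alg"
  assumes mon: "\<And>w c. P (mon w c)" and add: "\<And>f g. P f \<Longrightarrow> P g \<Longrightarrow> P (f + g)"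
  shows "P f"
proof (induction f rule: Poly_Mapping.update_induct)
  case const
  show ?case using mon[of "[]" 0] by simp
next
  case (update f w c)
  have "Poly_Mapping.update w c f = mon w c + f"
    using update by (intro poly_mapping_eqI) (auto simp: lookup_update lookup_add lookup_single in_keys_iff)
  then show ?case using add[OF mon update(3)] by simp
qed

lemma cst_commute: "f * cst c = cst c * f"
  by (induction f rule: free_alg_induct) (simp_all add: cst_def mon_mult mult.commute algebra_simps)

lemma cst_left_commute: "f * (cst c * g) = cst c * (f * g)"
  by (metis cst_commute mult.assoc)

lemma cst_cst: "cst c * (cst d * f) = cst (c * d) * f"
  by (simp add: cst_mult mult.assoc)

lemma lk_cst_mult: "lk (cst c * f) = (\<lambda>w. c * lk f w)"
  by (induction f rule: free_alg_induct)
     (auto simp: cst_def mon_mult lookup_single lookup_add algebra_simps fun_eq_iff when_def)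

text \<open>Both sides are bilinear, so monomials suffice; among all cuts of a word only the one at
  \<open>length w\<close> can contribute.\<close>

lemma lk_mult: "lk (f * g) = fa_mult (lk f) (lk g)"
proof (induction f rule: free_alg_induct)
  case (mon w c)
  show ?case
  proof (induction g rule: free_alg_induct)
    case (mon w' d)
    have "(\<Sum>i\<le>length z. (c when w = take i z) * (d when w' = drop i z)) = (c * d when w @ w' = z)" for z
    proof (cases "w @ w' = z")
      case True
      have "(\<Sum>i\<le>length z. (c when w = take i z) * (d when w' = drop i z))
          = (\<Sum>i\<le>length z. if i = length w then c * d else 0)"
      proof (intro sum.cong refl)
        fix i assume "i \<in> {..length z}"
        then have "w = take i z \<longleftrightarrow> i = length w" using True by (metis append_eq_conv_conj length_take min.absorb2 atMost_iff)
        then show "(c when w = take i z) * (d when w' = drop i z) = (if i = length w then c * d else 0)"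
          using True by auto
      qed
      then show ?thesis using True by auto
    next
      case False
      then have "(c when w = take i z) * (d when w' = drop i z) = 0" for i
        by (auto simp: when_def)
      then show ?thesis using False by (simp only: when_def if_False sum.neutral_const)
    qed
    then show ?case by (simp add: mon_mult fa_mult_def lookup_single fun_eq_iff)
  next
    case (add f g)
    then show ?case by (simp add: distrib_left fun_eq_iff lookup_add fa_mult_def sum.distrib)
  qed
next
  case (add f g)
  then show ?case by (simp add: distrib_right fun_eq_iff lookup_add fa_mult_def sum.distrib)
qed

lemma mon_Nil [simp]: "mon [] c = cst c"
  and mon_snoc: "mon (w @ [b]) c = mon w c * (if b then V else U)"
  by (simp_all add: cst_def U_def V_def mon_mult)

lemma lk_in_FA [simp]: "lk f \<in> FA"
  by (simp add: FA_def)

lemma FA_E: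
  assumes "b \<in> FA"
  obtains f where "b = lk f"
  using assms lookup_Abs_poly_mapping[of b] unfolding FA_def by (metis mem_Collect_eq)

lemma ball_FA_iff: "(\<forall>b\<in>FA. P b) \<longleftrightarrow> (\<forall>f. P (lk f))"
  by (metis FA_E lk_in_FA)

section \<open>The two-sided ideal generated by one element\<close>

definition ideal_of :: "'k::field free_alg \<Rightarrow> 'k free_alg set" where
  "ideal_of r = {f. lk f \<in> I_rel (lk r)}"

lemma lk_in_I_rel_iff [simp]: "lk f \<in> I_rel (lk r) \<longleftrightarrow> f \<in> ideal_of r"
  by (simp add: ideal_of_def)

lemma ideal_of_gen: "r \<in> ideal_of r"
  by (simp add: ideal_of_def I_rel_def ideal_gen.gen)

lemma ideal_of_zero [simp]: "0 \<in> ideal_of r"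
  using ideal_gen.zero[of FA fa_mult "{lk r}"]
  by (simp add: ideal_of_def I_rel_def lookup_zero[abs_def])

lemma ideal_of_add: "f \<in> ideal_of r \<Longrightarrow> g \<in> ideal_of r \<Longrightarrow> f + g \<in> ideal_of r"
  unfolding ideal_of_def I_rel_def mem_Collect_eq lookup_add[abs_def] by (rule ideal_gen.add)

lemma ideal_of_lmult: "f \<in> ideal_of r \<Longrightarrow> g * f \<in> ideal_of r"
  unfolding ideal_of_def I_rel_def mem_Collect_eq lk_mult by (rule ideal_gen.lmult) simp_all

lemma ideal_of_rmult: "f \<in> ideal_of r \<Longrightarrow> f * g \<in> ideal_of r"
  unfolding ideal_of_def I_rel_def mem_Collect_eq lk_mult by (rule ideal_gen.rmult) simp_all

lemma ideal_of_uminus: "f \<in> ideal_of r \<Longrightarrow> - f \<in> ideal_of r"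
  using ideal_of_lmult[of f r "- 1"] by simp

lemma ideal_of_diff: "f \<in> ideal_of r \<Longrightarrow> g \<in> ideal_of r \<Longrightarrow> f - g \<in> ideal_of r"
  using ideal_of_add[of f r "- g"] ideal_of_uminus by auto

text \<open>\<open>I_rel\<close> consists of bare functions, so the induction carries along a
  finitely supported representative. Scalars are absorbed into \<open>lmult\<close> through
  \<open>cst\<close>.\<close>

lemma I_rel_induct:
  assumes "b \<in> I_rel (lk r)" and gen: "P r" and zero: "P 0"
    and add: "\<And>f g. f \<in> ideal_of r \<Longrightarrow> g \<in> ideal_of r \<Longrightarrow> P f \<Longrightarrow> P g \<Longrightarrow> P (f + g)"
    and lmult: "\<And>f g. f \<in> ideal_of r \<Longrightarrow> P f \<Longrightarrow> P (g * f)"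
    and rmult: "\<And>f g. f \<in> ideal_of r \<Longrightarrow> P f \<Longrightarrow> P (f * g)"
  shows "\<exists>g. b = lk g \<and> g \<in> ideal_of r \<and> P g"
  using assms(1) unfolding I_rel_def
proof induction
  case (gen s)
  then show ?case using assms(2) ideal_of_gen by blast
next
  case zero
  show ?case by (rule exI[of _ 0]) (use assms(3) in \<open>simp add: fun_eq_iff\<close>)
next
  case (add b c)
  then obtain f g where "b = lk f" "c = lk g" "f \<in> ideal_of r" "g \<in> ideal_of r" "P f" "P g"
    by auto
  then show ?case
    by (intro exI[of _ "f + g"]) (auto simp: assms(4) ideal_of_add lookup_add[abs_def])
next
  case (smult b c)
  then obtain f where "b = lk f" "f \<in> ideal_of r" "P f" by auto
  then show ?case
    by (intro exI[of _ "cst c * f"]) (auto simp: lmult ideal_of_lmult lk_cst_mult)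
next
  case (lmult c b)
  then obtain f where "b = lk f" "f \<in> ideal_of r" "P f" by auto
  moreover obtain g where "c = lk g" using lmult by (auto elim: FA_E)
  ultimately show ?case
    by (intro exI[of _ "g * f"]) (auto simp: assms(5) ideal_of_lmult lk_mult)
next
  case (rmult c b)
  then obtain f where "b = lk f" "f \<in> ideal_of r" "P f" by auto
  moreover obtain g where "c = lk g" using rmult by (auto elim: FA_E)
  ultimately show ?case
    by (intro exI[of _ "f * g"]) (auto simp: assms(6) ideal_of_rmult lk_mult)
qed

lemma ideal_of_induct [consumes 1, case_names gen zero add lmult rmult]:
  assumes "f \<in> ideal_of r" and gen: "P r" and zero: "P 0"
    and add: "\<And>f g. f \<in> ideal_of r \<Longrightarrow> g \<in> ideal_of r \<Longrightarrow> P f \<Longrightarrow> P g \<Longrightarrow> P (f + g)"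
    and lmult: "\<And>f g. f \<in> ideal_of r \<Longrightarrow> P f \<Longrightarrow> P (g * f)"
    and rmult: "\<And>f g. f \<in> ideal_of r \<Longrightarrow> P f \<Longrightarrow> P (f * g)"
  shows "P f"
proof -
  have "lk f \<in> I_rel (lk r)" using assms(1) by simp
  from I_rel_induct[of "lk f" r P, OF this gen zero add lmult rmult]
  show ?thesis by (auto simp flip: poly_mapping_eq_iff)
qed

subsection \<open>The normal form modulo the relation\<close>

locale quantum_plane =
  fixes q lam :: "'k::field_char_0"
  assumes q_nz: "q \<noteq> 0" and lam_q: "lam = 0 \<or> q = 1"
begin

definition rl :: "'k free_alg" where
  "rl = V * U - cst q * (U * V) - cst lam * (U * U)"

definition eqv :: "'k free_alg \<Rightarrow> 'k free_alg \<Rightarrow> bool" (infix \<open>\<simeq>\<close> 50) where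
  "f \<simeq> g \<longleftrightarrow> f - g \<in> ideal_of rl"

lemma eqv_refl [simp]: "f \<simeq> f"
  by (simp add: eqv_def)

lemma eqv_sym: "f \<simeq> g \<Longrightarrow> g \<simeq> f"
  unfolding eqv_def using ideal_of_uminus[of "f - g" rl] by simp

lemma eqv_trans [trans]: "f \<simeq> g \<Longrightarrow> g \<simeq> h \<Longrightarrow> f \<simeq> h"
  unfolding eqv_def using ideal_of_add[of "f - g" rl "g - h"] by simp

lemma eqv_add: "f \<simeq> f' \<Longrightarrow> g \<simeq> g' \<Longrightarrow> f + g \<simeq> f' + g'"
  unfolding eqv_def using ideal_of_add[of "f - f'" rl "g - g'"] by (simp add: algebra_simps)

lemma eqv_diff: "f \<simeq> f' \<Longrightarrow> g \<simeq> g' \<Longrightarrow> f - g \<simeq> f' - g'"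
  unfolding eqv_def using ideal_of_diff[of "f - f'" rl "g - g'"] by (simp add: algebra_simps)

lemma eqv_lmult: "f \<simeq> f' \<Longrightarrow> g * f \<simeq> g * f'"
  unfolding eqv_def using ideal_of_lmult[of "f - f'" rl g] by (simp add: algebra_simps)

lemma eqv_rmult: "f \<simeq> f' \<Longrightarrow> f * g \<simeq> f' * g"
  unfolding eqv_def using ideal_of_rmult[of "f - f'" rl g] by (simp add: algebra_simps)

lemma eqv_sum: "(\<And>x. x \<in> A \<Longrightarrow> f x \<simeq> g x) \<Longrightarrow> sum f A \<simeq> sum g A"
  by (induction A rule: infinite_finite_induct) (auto intro: eqv_add)

lemma eqv_0_iff: "f \<simeq> 0 \<longleftrightarrow> f \<in> ideal_of rl"
  by (simp add: eqv_def)

lemma VU_eqv: "V * U \<simeq> cst q * (U * V) + cst lam * (U * U)"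
  using ideal_of_gen[of rl] by (simp add: eqv_def rl_def algebra_simps)

lemma UV_eqv: "U * V \<simeq> cst (inverse q) * (V * U - cst lam * (U * U))"
proof -
  have "V * U - cst lam * (U * U) \<simeq> cst q * (U * V) + cst lam * (U * U) - cst lam * (U * U)"
    by (intro eqv_diff VU_eqv eqv_refl)
  from eqv_lmult[OF this, of "cst (inverse q)"]
  have "cst (inverse q) * (V * U - cst lam * (U * U)) \<simeq> U * V"
    using q_nz by (simp flip: mult.assoc cst_mult)
  then show ?thesis by (rule eqv_sym)
qed

text \<open>Inductive, so that once it is known to be the whole algebra its induction rule becomes
  \<open>normal_induct\<close>.\<close>

inductive_set normal_span :: "'k free_alg set" where
  ideal: "f \<in> ideal_of rl \<Longrightarrow> f \<in> normal_span"
| normal: "V ^ j * U ^ i \<in> normal_span"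
| add: "f \<in> normal_span \<Longrightarrow> g \<in> normal_span \<Longrightarrow> f + g \<in> normal_span"
| scale: "f \<in> normal_span \<Longrightarrow> cst c * f \<in> normal_span"

lemma normal_span_eqv: "f \<simeq> g \<Longrightarrow> g \<in> normal_span \<Longrightarrow> f \<in> normal_span"
  using normal_span.add[OF normal_span.ideal, of "f - g" g] by (simp add: eqv_def)

lemma normal_span_diff:
  assumes "f \<in> normal_span" "g \<in> normal_span" shows "f - g \<in> normal_span"
proof -
  have "f + cst (- 1) * g \<in> normal_span" using assms by (intro normal_span.add normal_span.scale)
  then show ?thesis by (simp add: cst_minus)
qed

lemma normal_span_U: "f \<in> normal_span \<Longrightarrow> f * U \<in> normal_span"
proof (induction rule: normal_span.induct)
  case (ideal f)
  then show ?case by (intro normal_span.ideal ideal_of_rmult)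
next
  case (normal j i)
  show ?case using normal_span.normal[of j "Suc i"] by (simp add: mult.assoc power_commutes)
next
  case (add f g)
  then show ?case by (simp add: distrib_right normal_span.add)
next
  case (scale f c)
  then show ?case by (simp add: mult.assoc normal_span.scale)
qed

text \<open>A final \<open>V\<close> is moved left past one \<open>U\<close> at a time by
  \<open>UV_eqv\<close>; the correction term \<open>U * U\<close> leaves a normal monomial.\<close>

lemma normal_span_V: "f \<in> normal_span \<Longrightarrow> f * V \<in> normal_span"
proof (induction rule: normal_span.induct)
  case (ideal f)
  then show ?case by (intro normal_span.ideal ideal_of_rmult)
next
  case (normal j i)
  show ?case
  proof (induction i)
    case 0
    show ?case using normal_span.normal[of "Suc j" 0] by (simp add: power_commutes)
  next
    case (Suc i)
    have "V ^ j * U ^ Suc i * V = V ^ j * U ^ i * (U * V)"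
      by (simp only: power_Suc2 mult.assoc)
    also have "\<dots> \<simeq> V ^ j * U ^ i * (cst (inverse q) * (V * U - cst lam * (U * U)))"
      by (intro eqv_lmult UV_eqv)
    also have "\<dots> = cst (inverse q) * ((V ^ j * U ^ i * V) * U - cst lam * (V ^ j * U ^ i * U * U))"
      by (simp add: cst_left_commute[of "V ^ j"] cst_left_commute[of "U ^ i"] mult.assoc right_diff_distrib)
    finally show ?case
      by (rule normal_span_eqv)
        (intro normal_span.scale normal_span_diff normal_span_U Suc normal_span.normal)
  qed
next
  case (add f g)
  then show ?case by (simp add: distrib_right normal_span.add)
next
  case (scale f c)
  then show ?case by (simp add: mult.assoc normal_span.scale)
qed

lemma normal_span_UNIV: "f \<in> normal_span"
proof (induction f rule: free_alg_induct)
  case (mon w c)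
  show ?case
  proof (induction w rule: rev_induct)
    case Nil
    show ?case using normal_span.scale[OF normal_span.normal[of 0 0], of c] by simp
  next
    case (snoc b w)
    then show ?case by (simp add: mon_snoc normal_span_U normal_span_V)
  qed
qed (rule normal_span.add)

lemmas normal_induct [case_names ideal normal add scale] =
  normal_span.induct[OF normal_span_UNIV]

section \<open>Coefficient arrays and linear independence of the normal monomials\<close>

text \<open>Right multiplication by \<open>u\<close> and \<open>v\<close> on coefficient arrays, where \<open>F j i\<close> is the
  coefficient of \<open>v\<^sup>j u\<^sup>i\<close>; here \<open>u\<^sup>i v = q\<^sup>-\<^sup>i v u\<^sup>i - \<lambda> i u\<^sup>i\<^sup>+\<^sup>1\<close> because \<open>\<lambda> = 0\<close> or \<open>q = 1\<close>.\<close>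

definition RU :: "(nat \<Rightarrow> nat \<Rightarrow> 'k) \<Rightarrow> nat \<Rightarrow> nat \<Rightarrow> 'k" where
  "RU F j i = (case i of 0 \<Rightarrow> 0 | Suc i' \<Rightarrow> F j i')"

definition RV :: "(nat \<Rightarrow> nat \<Rightarrow> 'k) \<Rightarrow> nat \<Rightarrow> nat \<Rightarrow> 'k" where
  "RV F j i = (case j of 0 \<Rightarrow> 0 | Suc j' \<Rightarrow> inverse q ^ i * F j' i)
     - (case i of 0 \<Rightarrow> 0 | Suc i' \<Rightarrow> lam * of_nat i' * F j i')"

text \<open>This makes the arrays a right module over the quotient; in \<open>V * U\<close> the
  letter \<open>V\<close> acts first. By \<open>lam_q\<close> the \<open>lam\<close> terms of both
  sides agree.\<close>

lemma RV_RU: "RU (RV F) j i = q * RV (RU F) j i + lam * RU (RU F) j i"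
  using lam_q q_nz by (auto simp: RU_def RV_def algebra_simps split: nat.split)

text \<open>The starting array is that of 1; \<open>nf_normal\<close> and \<open>nf_eqv\<close> show
  that the action on it computes coordinates in the normal monomials.\<close>

definition nfw :: "word \<Rightarrow> nat \<Rightarrow> nat \<Rightarrow> 'k" where
  "nfw w = foldl (\<lambda>F b. if b then RV F else RU F) (\<lambda>j i. if j = 0 \<and> i = 0 then 1 else 0) w"

definition nf :: "'k free_alg \<Rightarrow> nat \<Rightarrow> nat \<Rightarrow> 'k" where
  "nf f j i = (\<Sum>w\<in>Poly_Mapping.keys f. lk f w * nfw w j i)"

lemma nf_add: "nf (f + g) j i = nf f j i + nf g j i"
  unfolding nf_def
  by (rule setsum_keys_plus_distrib[where f = "\<lambda>w c. c * nfw w j i"]) (auto simp: algebra_simps)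

lemma nf_0 [simp]: "nf 0 j i = 0"
  by (simp add: nf_def)

lemma nf_mon: "nf (mon w c) j i = c * nfw w j i"
  by (simp add: nf_def)

lemma nf_cst_mult: "nf (cst c * f) j i = c * nf f j i"
  by (induction f rule: free_alg_induct)
     (simp_all add: distrib_left nf_add nf_mon cst_def mon_mult del: mon_Nil)

lemma nf_uminus: "nf (- f) j i = - nf f j i"
  using nf_cst_mult[of "- 1" f j i] by (simp add: cst_minus)

lemma nf_diff: "nf (f - g) j i = nf f j i - nf g j i"
  using nf_add[of f "- g"] by (simp add: nf_uminus)

lemma RU_add: "RU (\<lambda>j i. F j i + G j i) j i = RU F j i + RU G j i"
  and RU_scale: "RU (\<lambda>j i. c * F j i) j i = c * RU F j i"
  and RV_add: "RV (\<lambda>j i. F j i + G j i) j i = RV F j i + RV G j i"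
  and RV_scale: "RV (\<lambda>j i. c * F j i) j i = c * RV F j i"
  by (simp_all add: RU_def RV_def algebra_simps split: nat.split)

lemma nf_mult_U: "nf (f * U) = RU (nf f)"
proof -
  have "nf (f * U) j i = RU (nf f) j i" for j i
  proof (induction f rule: free_alg_induct)
    case (mon w c)
    have "mon w c * U = mon (w @ [False]) c" by (simp add: mon_snoc)
    then show ?case by (simp add: nf_mon nf_mon[abs_def] RU_scale nfw_def)
  next
    case (add f g)
    then show ?case by (simp add: distrib_right nf_add nf_add[abs_def] RU_add)
  qed
  then show ?thesis by (simp add: fun_eq_iff)
qed

lemma nf_mult_V: "nf (f * V) = RV (nf f)"
proof -
  have "nf (f * V) j i = RV (nf f) j i" for j i
  proof (induction f rule: free_alg_induct)
    case (mon w c)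
    have "mon w c * V = mon (w @ [True]) c" by (simp add: mon_snoc)
    then show ?case by (simp add: nf_mon nf_mon[abs_def] RV_scale nfw_def)
  next
    case (add f g)
    then show ?case by (simp add: distrib_right nf_add nf_add[abs_def] RV_add)
  qed
  then show ?thesis by (simp add: fun_eq_iff)
qed

lemma nf_mult_zero:
  assumes "nf f = (\<lambda>j i. 0)" shows "nf (f * g) = (\<lambda>j i. 0)"
proof (induction g rule: free_alg_induct)
  case (mon w c)
  show ?case
  proof (induction w rule: rev_induct)
    case Nil
    show ?case using assms by (simp add: fun_eq_iff cst_commute nf_cst_mult)
  next
    case (snoc b w)
    then show ?case
      by (simp add: mon_snoc nf_mult_U nf_mult_V fun_eq_iff RU_def RV_def split: nat.split
            flip: mult.assoc)
  qed
next
  case (add g h)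
  then show ?case by (simp add: distrib_left nf_add fun_eq_iff)
qed

lemma nf_ideal:
  assumes "f \<in> ideal_of rl" shows "nf f = (\<lambda>j i. 0)"
proof -
  \<comment> \<open>\<open>nf\<close> is compatible with right multiplication only, so an arbitrary
    left factor is built into the claim; the case \<open>lmult\<close> is then immediate.\<close>
  have "\<forall>c. nf (c * f) = (\<lambda>j i. 0)"
    using assms
  proof (induction rule: ideal_of_induct)
    case gen
    have "c * rl = c * V * U - cst q * (c * U * V) - cst lam * (c * U * U)" for c
      by (simp add: rl_def right_diff_distrib cst_left_commute[of c] mult.assoc)
    then show ?case
      by (simp add: nf_diff nf_cst_mult nf_mult_U nf_mult_V RV_RU fun_eq_iff)
  next
    case (lmult f g)
    then show ?case by (simp flip: mult.assoc)
  next
    case (rmult f g)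
    then show ?case by (simp add: nf_mult_zero flip: mult.assoc)
  qed (simp_all add: distrib_left nf_add fun_eq_iff)
  from this[rule_format, of 1] show ?thesis by simp
qed

lemma nf_eqv: "f \<simeq> g \<Longrightarrow> nf f = nf g"
  unfolding eqv_def by (drule nf_ideal) (simp add: fun_eq_iff nf_diff)

lemma nf_normal: "nf (V ^ j * U ^ i) = (\<lambda>j' i'. if j' = j \<and> i' = i then 1 else 0)"
proof (induction i)
  case 0
  show ?case
  proof (induction j)
    case 0
    show ?case using nf_mon[of "[]" 1] by (simp add: fun_eq_iff nfw_def)
  next
    case (Suc j)
    then have "nf (V ^ Suc j * U ^ 0) = RV (\<lambda>j' i'. if j' = j \<and> i' = 0 then 1 else 0)"
      by (simp add: power_Suc2 nf_mult_V del: power_Suc)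
    then show ?case by (auto simp: fun_eq_iff RV_def split: nat.split)
  qed
next
  case (Suc i)
  then have "nf (V ^ j * U ^ Suc i) = RU (\<lambda>j' i'. if j' = j \<and> i' = i then 1 else 0)"
    by (simp add: power_Suc2 nf_mult_U del: power_Suc flip: mult.assoc)
  then show ?case by (auto simp: fun_eq_iff RU_def split: nat.split)
qed

text \<open>Stating the expansion for all large cutoffs lets two expansions be added at a common
  one.\<close>

lemma normal_form:
  "\<exists>N. \<forall>M\<ge>N. f \<simeq> (\<Sum>j<M. \<Sum>i<M. cst (nf f j i) * (V ^ j * U ^ i))"
proof (induction f rule: normal_induct)
  case (ideal f)
  then show ?case by (simp add: nf_ideal eqv_0_iff)
next
  case (normal j i)
  have "V ^ j * U ^ i \<simeq> (\<Sum>j'<M. \<Sum>i'<M. cst (nf (V ^ j * U ^ i) j' i') * (V ^ j' * U ^ i'))"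
    if "M \<ge> Suc (max i j)" for M
  proof -
    have "cst (nf (V ^ j * U ^ i) j' i') * (V ^ j' * U ^ i')
        = (if i' = i then if j' = j then V ^ j * U ^ i else 0 else 0)" for j' i'
      by (auto simp: nf_normal)
    moreover have "i < M" "j < M" using that by auto
    ultimately show ?thesis by simp
  qed
  then show ?case by blast
next
  case (add f g)
  then obtain N N' where
    "\<forall>M\<ge>N. f \<simeq> (\<Sum>j<M. \<Sum>i<M. cst (nf f j i) * (V ^ j * U ^ i))"
    "\<forall>M\<ge>N'. g \<simeq> (\<Sum>j<M. \<Sum>i<M. cst (nf g j i) * (V ^ j * U ^ i))" by blast
  then show ?case
    by (intro exI[of _ "max N N'"]) (auto simp: nf_add cst_add distrib_right sum.distrib intro!: eqv_add)
next
  case (scale f c)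
  then obtain N where "\<forall>M\<ge>N. f \<simeq> (\<Sum>j<M. \<Sum>i<M. cst (nf f j i) * (V ^ j * U ^ i))" by blast
  then have "\<forall>M\<ge>N. cst c * f \<simeq> cst c * (\<Sum>j<M. \<Sum>i<M. cst (nf f j i) * (V ^ j * U ^ i))"
    by (auto intro: eqv_lmult)
  then show ?case
    by (intro exI[of _ N]) (simp add: nf_cst_mult cst_mult sum_distrib_left mult.assoc)
qed

text \<open>Independence is \<open>nf_ideal\<close>, spanning is \<open>normal_form\<close>.\<close>

lemma ideal_iff_nf: "f \<in> ideal_of rl \<longleftrightarrow> nf f = (\<lambda>j i. 0)"
  using nf_ideal normal_form[of f] by (auto simp: eqv_0_iff)

text \<open>With \<open>U\<close> on the right of the normal monomials, right multiplication by
  \<open>U\<close> merely shifts arrays.\<close>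

lemma U_cancel: "f * U \<simeq> g * U \<Longrightarrow> f \<simeq> g"
proof -
  assume "f * U \<simeq> g * U"
  then have "RU (nf f) j (Suc i) = RU (nf g) j (Suc i)" for j i
    by (simp add: nf_eqv flip: nf_mult_U)
  then show "f \<simeq> g"
    by (simp add: eqv_def ideal_iff_nf fun_eq_iff nf_diff RU_def)
qed

lemma U_power_cancel: "f * U ^ m \<simeq> g * U ^ m \<Longrightarrow> f \<simeq> g"
  by (induction m) (auto simp: power_Suc2 simp del: power_Suc simp flip: mult.assoc dest: U_cancel)

lemma eqv_mult_U_if_nf:
  assumes "\<And>j. nf f j 0 = 0" shows "\<exists>g. f \<simeq> g * U"
proof -
  obtain M where M: "f \<simeq> (\<Sum>j<M. \<Sum>i<M. cst (nf f j i) * (V ^ j * U ^ i))"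
    using normal_form by blast
  \<comment> \<open>At \<open>i = 0\<close> the exponent \<open>i - 1\<close> is truncated, but
    there the coefficient vanishes.\<close>
  have "cst (nf f j i) * (V ^ j * U ^ i) = cst (nf f j i) * (V ^ j * U ^ (i - 1)) * U" for j i
    using assms by (cases i) (simp_all add: mult.assoc power_commutes)
  then have "f \<simeq> (\<Sum>j<M. \<Sum>i<M. cst (nf f j i) * (V ^ j * U ^ (i - 1))) * U"
    using M by (simp add: sum_distrib_right)
  then show ?thesis by blast
qed

section \<open>Conjugates of v and divisibility by powers of u\<close>

text \<open>\<open>S m\<close> is the conjugate \<open>u\<^sup>-\<^sup>m v u\<^sup>m\<close>.\<close>

primrec mu :: "nat \<Rightarrow> 'k" where
  "mu 0 = 0"
| "mu (Suc m) = mu m + lam * q ^ m"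

lemma mu_eq: "mu m = lam * (\<Sum>i<m. q ^ i)"
  by (induction m) (simp_all add: distrib_left)

definition S :: "nat \<Rightarrow> 'k free_alg" where
  "S m = cst (q ^ m) * V + cst (mu m) * U"

lemma S_0 [simp]: "S 0 = V"
  by (simp add: S_def)

lemma U_S: "S m * U \<simeq> U * S (Suc m)"
proof -
  have "S m * U = cst (q ^ m) * (V * U) + cst (mu m) * (U * U)"
    by (simp add: S_def distrib_right mult.assoc)
  also have "\<dots> \<simeq> cst (q ^ m) * (cst q * (U * V) + cst lam * (U * U)) + cst (mu m) * (U * U)"
    by (intro eqv_add eqv_lmult VU_eqv eqv_refl)
  also have "\<dots> = U * S (Suc m)"
    by (simp add: S_def distrib_left distrib_right cst_left_commute[of U] cst_cst cst_add
          mult.commute[of q] mult.commute[of lam])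
  finally show ?thesis .
qed

lemma U_S_power: "S m ^ p * U \<simeq> U * S (Suc m) ^ p"
proof (induction p)
  case (Suc p)
  have "S m ^ Suc p * U = S m * (S m ^ p * U)" by (simp add: mult.assoc)
  also have "\<dots> \<simeq> S m * (U * S (Suc m) ^ p)" by (intro eqv_lmult Suc)
  also have "\<dots> = (S m * U) * S (Suc m) ^ p" by (simp add: mult.assoc)
  also have "\<dots> \<simeq> (U * S (Suc m)) * S (Suc m) ^ p" by (intro eqv_rmult U_S)
  finally show ?case by (simp add: mult.assoc)
qed simp

lemma Upow_S_power: "S m ^ p * U ^ l \<simeq> U ^ l * S (m + l) ^ p"
proof (induction l)
  case (Suc l)
  have "S m ^ p * U ^ Suc l = (S m ^ p * U ^ l) * U" by (simp add: mult.assoc power_commutes)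
  also have "\<dots> \<simeq> (U ^ l * S (m + l) ^ p) * U" by (intro eqv_rmult Suc)
  also have "\<dots> = U ^ l * (S (m + l) ^ p * U)" by (simp add: mult.assoc)
  also have "\<dots> \<simeq> U ^ l * (U * S (Suc (m + l)) ^ p)" by (intro eqv_lmult U_S_power)
  also have "\<dots> = U ^ Suc l * S (m + Suc l) ^ p" by (simp add: mult.assoc power_commutes flip: mult.assoc)
  finally show ?case .
qed simp

text \<open>Column 0 of the array is the image in A/(u) = k[v], where \<open>S m\<close> becomes
  \<open>q ^ m\<close> times v.\<close>

lemma nf_mult_S_power: "nf (f * S m ^ p) (j + p) 0 = q ^ (m * p) * nf f j 0"
proof (induction p)
  case (Suc p)
  have "f * S m ^ Suc p = cst (q ^ m) * (f * S m ^ p * V) + cst (mu m) * (f * S m ^ p * U)"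
    by (simp only: power_Suc2 mult.assoc[symmetric], subst (2) S_def)
       (simp add: distrib_left cst_left_commute[of f] cst_left_commute[of "S m ^ p"] mult.assoc)
  then show ?case
    using Suc by (simp add: nf_add nf_cst_mult nf_mult_U nf_mult_V RU_def RV_def power_add)
qed simp

text \<open>Modulo u the hypothesis for \<open>Suc m\<close> says that \<open>f\<close> times a
  nonzero multiple of a power of v is 0 in the domain k[v], so \<open>f\<close> is some
  \<open>c * U\<close>. Moving this \<open>U\<close> to the right turns \<open>S (Suc m)\<close>
  into \<open>S m\<close>, and cancelling it leaves the case \<open>m\<close> for
  \<open>c\<close>.\<close>

lemma eqv_mult_U_power:
  "f * S m ^ p \<simeq> g * U ^ m \<Longrightarrow> \<exists>c. f \<simeq> c * U ^ m"
proof (induction m arbitrary: f)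
  case 0
  show ?case by (rule exI[of _ f]) simp
next
  case (Suc m)
  have gU: "g * U ^ Suc m = g * U ^ m * U" by (simp add: mult.assoc power_commutes)
  have "nf f j 0 = 0" for j
  proof -
    have "nf (f * S (Suc m) ^ p) (j + p) 0 = nf (g * U ^ m * U) (j + p) 0"
      using Suc.prems gU by (simp add: nf_eqv)
    then show ?thesis using q_nz by (simp add: nf_mult_S_power nf_mult_U RU_def)
  qed
  then obtain c where c: "f \<simeq> c * U" using eqv_mult_U_if_nf by blast
  have "c * S m ^ p * U = c * (S m ^ p * U)" by (simp add: mult.assoc)
  also have "\<dots> \<simeq> c * (U * S (Suc m) ^ p)" by (intro eqv_lmult U_S_power)
  also have "\<dots> = c * U * S (Suc m) ^ p" by (simp add: mult.assoc)
  also have "\<dots> \<simeq> f * S (Suc m) ^ p" by (intro eqv_rmult eqv_sym[OF c])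
  also have "\<dots> \<simeq> g * U ^ m * U" using Suc.prems gU by simp
  finally have "c * S m ^ p \<simeq> g * U ^ m" by (rule U_cancel)
  then obtain d where d: "c \<simeq> d * U ^ m" using Suc.IH by blast
  have "f \<simeq> d * U ^ m * U" using c eqv_rmult[OF d, of U] by (rule eqv_trans)
  then show ?case by (auto simp: mult.assoc power_commutes)
qed

end

subsection \<open>The cyclic group action\<close>

text \<open>\<open>lam_a\<close> makes the relation homogeneous: when \<open>U * U\<close> occurs,
  \<open>a = 1\<close> gives all its monomials the same weight.\<close>

locale quantum_plane_cyclic = quantum_plane q lam for q lam :: "'k::field_char_0" +
  fixes \<omega> :: 'k and n a :: nat
  assumes n_pos: "n > 0" and omega_n: "\<omega> ^ n = 1"
    and omega_prim: "\<And>m. 0 < m \<Longrightarrow> m < n \<Longrightarrow> \<omega> ^ m \<noteq> 1"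
    and coprime_a: "coprime a n" and lam_a: "lam = 0 \<or> a = 1"
begin

lemma omega_power_mod: "\<omega> ^ (m mod n) = \<omega> ^ m"
proof -
  have "\<omega> ^ m = \<omega> ^ (n * (m div n) + m mod n)" by simp
  also have "\<dots> = \<omega> ^ (m mod n)" by (simp only: power_add power_mult omega_n power_one mult_1)
  finally show ?thesis by simp
qed

lemma omega_power_cong: "i mod n = j mod n \<Longrightarrow> \<omega> ^ (k * i) = \<omega> ^ (k * j)"
  by (metis omega_power_mod mod_mult_right_eq)

lemma omega_power_eq_1_iff: "\<omega> ^ m = 1 \<longleftrightarrow> n dvd m"
  using omega_prim[of "m mod n"] n_pos omega_power_mod[of m] by (auto simp: dvd_eq_mod_eq_0)

text \<open>Orthogonality of characters: unless \<open>n\<close> divides \<open>m\<close>, this is a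
  geometric sum with ratio different from 1.\<close>

lemma omega_sum: "(\<Sum>k<n. \<omega> ^ (k * m)) = (if n dvd m then of_nat n else 0)"
proof (cases "n dvd m")
  case True
  then have "\<omega> ^ (k * m) = 1" for k by (simp add: omega_power_eq_1_iff)
  then show ?thesis using True by simp
next
  case False
  have "(\<Sum>k<n. \<omega> ^ (k * m)) = (\<Sum>k<n. (\<omega> ^ m) ^ k)"
    by (simp add: power_mult mult.commute flip: power_mult)
  also have "\<dots> = ((\<omega> ^ m) ^ n - 1) / (\<omega> ^ m - 1)"
    using False by (simp add: geometric_sum omega_power_eq_1_iff)
  also have "(\<omega> ^ m) ^ n = 1" by (simp add: omega_n flip: power_mult mult.commute[of n m] add: power_mult)
  finally show ?thesis using False by simp
qed

text \<open>Exponents are natural numbers, so \<open>n - l\<close> stands for the inverse character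
  in Fourier inversion. The sum lies strictly between 0 and \<open>2 * n\<close>.\<close>

lemma dvd_shift_iff: "k < n \<Longrightarrow> l < n \<Longrightarrow> n dvd k + (n - l) \<longleftrightarrow> k = l"
proof
  assume "k < n" "l < n" "n dvd k + (n - l)"
  then obtain d where d: "k + (n - l) = n * d" by (auto elim: dvdE)
  have "0 < n * d" "n * d < n * 2" using \<open>k < n\<close> \<open>l < n\<close> d by linarith+
  then have "d = 1" by simp
  then show "k = l" using d \<open>l < n\<close> by simp
qed simp

lemma weight_append: "weight a (w @ w') = weight a w + weight a w'"
  by (simp add: weight_def algebra_simps)

definition actf :: "nat \<Rightarrow> 'k free_alg \<Rightarrow> 'k free_alg" where
  "actf k f = Poly_Mapping.mapp (\<lambda>w c. \<omega> ^ (k * weight a w) * c) f"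

lemma lk_actf: "lk (actf k f) = act \<omega> a k (lk f)"
  by (auto simp: fun_eq_iff actf_def act_def lookup_mapp when_def in_keys_iff)

lemma actf_mon: "actf k (mon w c) = mon w (\<omega> ^ (k * weight a w) * c)"
  by (rule poly_mapping_eqI) (auto simp: lk_actf act_def lookup_single when_def)

lemma actf_add: "actf k (f + g) = actf k f + actf k g"
  by (rule poly_mapping_eqI) (simp add: lk_actf act_def lookup_add distrib_left)

lemma actf_0 [simp]: "actf k 0 = 0"
  using actf_mon[of k "[]" 0] by simp

lemma actf_cst [simp]: "actf k (cst c) = cst c"
  using actf_mon[of k "[]" c] by (simp add: weight_def)

lemma actf_mult: "actf k (f * g) = actf k f * actf k g"
proof (induction f rule: free_alg_induct)
  case (mon w c)
  show ?case
    by (induction g rule: free_alg_induct)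
      (simp_all add: mon_mult actf_mon weight_append distrib_left actf_add power_add mult_ac)
qed (simp add: distrib_right actf_add)

lemma actf_diff: "actf k (f - g) = actf k f - actf k g"
  using actf_add[of k "f - g" g] by (simp add: algebra_simps)

lemma actf_sum: "actf k (sum f A) = (\<Sum>x\<in>A. actf k (f x))"
  by (induction A rule: infinite_finite_induct) (simp_all add: actf_add)

lemma actf_actf: "actf k (actf l f) = actf (k + l) f"
  by (rule poly_mapping_eqI) (simp add: lk_actf act_def power_add distrib_right)

lemma actf_mod: "actf (k mod n) f = actf k f"
  using omega_power_cong[of "k mod n" k]
  by (intro poly_mapping_eqI) (simp add: lk_actf act_def mult.commute)

lemma actf_0_left [simp]: "actf 0 f = f"
  by (rule poly_mapping_eqI) (simp add: lk_actf act_def)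

text \<open>The eigenvalue equation holds in the free algebra itself, not just modulo the relation;
  by \<open>homog_cong\<close> the index counts modulo \<open>n\<close>.\<close>

definition homog :: "nat \<Rightarrow> 'k free_alg \<Rightarrow> bool" where
  "homog j f \<longleftrightarrow> (\<forall>k. actf k f = cst (\<omega> ^ (k * j)) * f)"

lemma homog_mult:
  assumes "homog i f" "homog j g" shows "homog (i + j) (f * g)"
  unfolding homog_def
proof
  fix k
  have "actf k (f * g) = cst (\<omega> ^ (k * i)) * f * (cst (\<omega> ^ (k * j)) * g)"
    using assms by (simp add: actf_mult homog_def)
  also have "\<dots> = cst (\<omega> ^ (k * i)) * (cst (\<omega> ^ (k * j)) * (f * g))"
    by (simp add: mult.assoc cst_left_commute[of f])
  finally show "actf k (f * g) = cst (\<omega> ^ (k * (i + j))) * (f * g)"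
    by (simp add: cst_cst power_add distrib_left)
qed

lemma homog_add: "homog i f \<Longrightarrow> homog i g \<Longrightarrow> homog i (f + g)"
  by (simp add: homog_def actf_add distrib_left)

lemma homog_cst: "homog 0 (cst c)"
  by (simp add: homog_def)

lemma homog_scale: "homog i f \<Longrightarrow> homog i (cst c * f)"
  using homog_mult[OF homog_cst] by fastforce

lemma homog_power: "homog i f \<Longrightarrow> homog (i * m) (f ^ m)"
proof (induction m)
  case 0
  show ?case using homog_cst[of 1] by simp
next
  case (Suc m)
  then show ?case using homog_mult[of i f "i * m" "f ^ m"] by simp
qed

lemma homog_mon: "homog (weight a w) (mon w c)"
  by (simp add: homog_def actf_mon cst_def mon_mult del: mon_Nil)

lemma homog_U: "homog 1 U" and homog_V: "homog a V"
  using homog_mon[of "[False]" 1] homog_mon[of "[True]" 1] by (simp_all add: U_def V_def weight_def)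

lemma homog_cong: "homog i f \<Longrightarrow> i mod n = j mod n \<Longrightarrow> homog j f"
  unfolding homog_def using omega_power_cong by metis

text \<open>Either the \<open>U\<close> term of \<open>S m\<close> vanishes, or \<open>a = 1\<close>
  and both letters have the same weight.\<close>

lemma homog_S: "homog a (S m)"
proof (cases "lam = 0")
  case True
  then have "mu m = 0" using mu_eq by (metis mult_zero_left)
  then show ?thesis by (simp add: S_def homog_scale homog_V)
next
  case False
  then have "a = 1" using lam_a by simp
  then show ?thesis using homog_U homog_V unfolding S_def by (intro homog_add homog_scale) simp_all
qed

lemma homog_invariant: "homog i f \<Longrightarrow> n dvd i \<Longrightarrow> actf k f = f"
  using omega_power_eq_1_iff[of "k * i"] by (simp add: homog_def)

lemma homog_rl: "homog (a + 1) rl"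
proof -
  have "homog (a + 1) (V * U)" "homog (1 + a) (U * V)" "homog (1 + 1) (U * U)"
    by (intro homog_mult homog_U homog_V)+
  then show ?thesis
    using lam_a by (auto simp: rl_def homog_def actf_diff actf_mult add.commute right_diff_distrib
      cst_left_commute[of "cst (\<omega> ^ _)"])
qed

lemma actf_ideal: "f \<in> ideal_of rl \<Longrightarrow> actf k f \<in> ideal_of rl"
proof (induction rule: ideal_of_induct)
  case gen
  show ?case using homog_rl by (simp add: homog_def ideal_of_lmult ideal_of_gen)
qed (simp_all add: actf_add actf_mult ideal_of_add ideal_of_lmult ideal_of_rmult)

lemma actf_eqv: "f \<simeq> g \<Longrightarrow> actf k f \<simeq> actf k g"
  unfolding eqv_def using actf_ideal[of "f - g" k] by (simp add: actf_diff)

subsection \<open>The Auslander map\<close>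

definition auslanderf :: "(nat \<Rightarrow> 'k free_alg) \<Rightarrow> 'k free_alg \<Rightarrow> 'k free_alg" where
  "auslanderf x f = (\<Sum>k<n. x k * actf k f)"

definition skew_mult :: "(nat \<Rightarrow> 'k free_alg) \<Rightarrow> (nat \<Rightarrow> 'k free_alg) \<Rightarrow> nat \<Rightarrow> 'k free_alg" where
  "skew_mult x y k = (\<Sum>k1<n. \<Sum>k2<n. if (k1 + k2) mod n = k then x k1 * actf k1 (y k2) else 0)"

lemma auslanderf_skew_mult: "auslanderf (skew_mult x y) f = auslanderf x (auslanderf y f)"
proof -
  have "auslanderf (skew_mult x y) f
      = (\<Sum>k<n. \<Sum>k1<n. \<Sum>k2<n. if (k1 + k2) mod n = k then x k1 * actf k1 (y k2) * actf k f else 0)"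
    unfolding auslanderf_def skew_mult_def sum_distrib_right by (intro sum.cong refl) simp
  also have "\<dots> = (\<Sum>k1<n. \<Sum>k<n. \<Sum>k2<n. if (k1 + k2) mod n = k then x k1 * actf k1 (y k2) * actf k f else 0)"
    by (rule sum.swap)
  also have "\<dots> = (\<Sum>k1<n. \<Sum>k2<n. \<Sum>k<n. if (k1 + k2) mod n = k then x k1 * actf k1 (y k2) * actf k f else 0)"
    by (intro sum.cong refl sum.swap)
  also have "\<dots> = (\<Sum>k1<n. \<Sum>k2<n. x k1 * actf k1 (y k2) * actf (k1 + k2) f)"
    using n_pos by (simp add: actf_mod)
  also have "\<dots> = auslanderf x (auslanderf y f)"
    by (simp add: auslanderf_def actf_sum sum_distrib_left actf_mult actf_actf mult.assoc)
  finally show ?thesis .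
qed

text \<open>The group acts on weight \<open>j\<close> by scalars, which leaves left multiplication
  by the Fourier coefficient of \<open>x\<close> at the character \<open>j\<close>.\<close>

lemma auslanderf_homog: "homog j f \<Longrightarrow> auslanderf x f = (\<Sum>k<n. cst (\<omega> ^ (k * j)) * x k) * f"
  unfolding auslanderf_def sum_distrib_right
  by (intro sum.cong refl) (simp add: homog_def cst_left_commute[of "x _"] mult.assoc)

text \<open>Evaluating at \<open>U ^ j\<close> and cancelling kills every Fourier coefficient
  \<open>y j\<close>; inversion recovers \<open>x l\<close> up to the factor \<open>n\<close>,
  invertible in characteristic 0.\<close>

lemma auslanderf_injective:
  assumes "\<And>f. auslanderf x f \<simeq> 0" and "l < n"
  shows "x l \<simeq> 0"
proof -
  define y where "y j = (\<Sum>k<n. cst (\<omega> ^ (k * j)) * x k)" for j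
  have "homog j (U ^ j)" for j using homog_power[OF homog_U, of j] by simp
  then have "y j * U ^ j \<simeq> 0 * U ^ j" for j
    using assms(1)[of "U ^ j"] auslanderf_homog[of j "U ^ j"] by (simp add: y_def)
  then have y: "y j \<simeq> 0" for j by (rule U_power_cancel)
  have "(\<Sum>j<n. cst (\<omega> ^ (j * (n - l))) * y j) = (\<Sum>k<n. (\<Sum>j<n. cst (\<omega> ^ (j * (k + (n - l)))) * x k))"
    unfolding y_def sum_distrib_left
    by (subst sum.swap) (intro sum.cong refl, simp add: cst_cst power_add distrib_left mult_ac del: add_diff_assoc)
  also have "\<dots> = (\<Sum>k<n. cst (\<Sum>j<n. \<omega> ^ (j * (k + (n - l)))) * x k)"
    by (simp add: cst_sum sum_distrib_right)
  also have "\<dots> = (\<Sum>k<n. if k = l then cst (of_nat n) * x k else 0)"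
    using assms(2) by (intro sum.cong refl) (auto simp: omega_sum dvd_shift_iff simp del: add_diff_assoc)
  also have "\<dots> = cst (of_nat n) * x l" using assms(2) by simp
  finally have "cst (of_nat n) * x l = (\<Sum>j<n. cst (\<omega> ^ (j * (n - l))) * y j)" by simp
  also have "\<dots> \<simeq> (\<Sum>j<n. cst (\<omega> ^ (j * (n - l))) * 0)" by (intro eqv_sum eqv_lmult y)
  finally have "cst (of_nat n) * x l \<simeq> 0" by simp
  from eqv_lmult[OF this, of "cst (inverse (of_nat n))"] show ?thesis
    using n_pos by (simp add: cst_cst)
qed

section \<open>Endomorphisms over the invariants\<close>

definition endo :: "('k free_alg \<Rightarrow> 'k free_alg) \<Rightarrow> bool" where
  "endo e \<longleftrightarrow> (\<forall>f g. f \<simeq> g \<longrightarrow> e f \<simeq> e g) \<and> (\<forall>f g. e (f + g) \<simeq> e f + e g) \<and>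
     (\<forall>f c. (\<forall>k<n. actf k c \<simeq> c) \<longrightarrow> e (f * c) \<simeq> e f * c)"

lemma auslanderf_endo: "endo (auslanderf x)"
  unfolding endo_def auslanderf_def
proof (intro conjI allI impI)
  fix f c assume c: "\<forall>k<n. actf k c \<simeq> c"
  have "(\<Sum>k<n. x k * actf k (f * c)) = (\<Sum>k<n. x k * actf k f * actf k c)"
    by (simp add: actf_mult mult.assoc)
  also have "\<dots> \<simeq> (\<Sum>k<n. x k * actf k f * c)" using c by (intro eqv_sum eqv_lmult) simp
  finally show "(\<Sum>k<n. x k * actf k (f * c)) \<simeq> (\<Sum>k<n. x k * actf k f) * c"
    by (simp add: sum_distrib_right)
qed (auto intro!: eqv_sum eqv_lmult actf_eqv simp: actf_add distrib_left sum.distrib)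

text \<open>Pulling \<open>U ^ m\<close> to the left replaces each \<open>V\<close> by its conjugate
  \<open>S m\<close>, which has the same weight.\<close>

lemma mon_U_power: "\<exists>s. homog (weight a w) s \<and> mon w c * U ^ m \<simeq> U ^ m * s"
proof (induction w rule: rev_induct)
  case Nil
  show ?case by (rule exI[of _ "cst c"]) (simp add: homog_cst weight_def cst_commute)
next
  case (snoc b w)
  then obtain s where s: "homog (weight a w) s" "mon w c * U ^ m \<simeq> U ^ m * s" by blast
  define t :: "'k free_alg" where "t = (if b then S m else U)"
  define z :: "'k free_alg" where "z = (if b then V else U)"
  have z: "z * U ^ m \<simeq> U ^ m * t"
    using Upow_S_power[of 0 1 m] by (simp add: z_def t_def power_commutes)
  have t: "homog (weight a [b]) t"
    using homog_S homog_U by (simp add: t_def weight_def)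
  have "mon (w @ [b]) c * U ^ m = mon w c * (z * U ^ m)" by (simp add: mon_snoc z_def mult.assoc)
  also have "\<dots> \<simeq> mon w c * (U ^ m * t)" by (intro eqv_lmult z)
  also have "\<dots> = (mon w c * U ^ m) * t" by (simp add: mult.assoc)
  also have "\<dots> \<simeq> (U ^ m * s) * t" by (intro eqv_rmult s)
  finally have "mon (w @ [b]) c * U ^ m \<simeq> U ^ m * (s * t)" by (simp add: mult.assoc)
  then show ?case using homog_mult[OF s(1) t] by (auto simp: weight_append)
qed

lemma endo_homog:
  assumes "endo e" and j: "j < n"
  shows "\<exists>c. \<forall>w d. weight a w mod n = j \<longrightarrow> e (mon w d) \<simeq> c * mon w d"
proof -
  have eqv: "f \<simeq> g \<Longrightarrow> e f \<simeq> e g" and lin: "homog i c \<Longrightarrow> n dvd i \<Longrightarrow> e (f * c) \<simeq> e f * c" for f g c i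
    using assms(1) homog_invariant[of i c] by (auto simp: endo_def)
  have Un: "homog n (U ^ n)" using homog_power[OF homog_U, of n] by simp
  have Un_split: "U ^ n = U ^ j * U ^ (n - j)" using j by (simp flip: power_add)
  \<comment> \<open>Both \<open>U ^ n\<close> and \<open>U ^ (n - j) * s\<close> are invariant, so
    either can be taken out of \<open>e\<close> on the right.\<close>
  have key: "e b * U ^ n \<simeq> e (U ^ j) * (U ^ (n - j) * s)"
    if b: "b * U ^ n \<simeq> U ^ n * s" and s: "homog j s" for b s
  proof -
    have "homog (n - j) (U ^ (n - j))" using homog_power[OF homog_U, of "n - j"] by simp
    then have hom: "homog n (U ^ (n - j) * s)" using homog_mult s j by fastforce
    have "e b * U ^ n \<simeq> e (b * U ^ n)" by (rule eqv_sym, rule lin[OF Un]) simp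
    also have "\<dots> \<simeq> e (U ^ n * s)" by (intro eqv b)
    also have "U ^ n * s = U ^ j * (U ^ (n - j) * s)" by (simp add: Un_split mult.assoc)
    also have "e \<dots> \<simeq> e (U ^ j) * (U ^ (n - j) * s)" using lin[OF hom] by simp
    finally show ?thesis .
  qed
  \<comment> \<open>As \<open>a\<close> is invertible modulo \<open>n\<close>, some power of
    \<open>V\<close> has weight \<open>j\<close>.\<close>
  obtain p where p: "(a * p) mod n = j"
  proof -
    obtain i where "[a * i = 1] (mod n)"
      using cong_solve_coprime_nat[OF coprime_a] by auto
    from cong_scalar_right[OF this, of j] have "[a * (i * j) = j] (mod n)" by (simp add: mult.assoc)
    then show thesis using that j by (simp add: cong_def)
  qed
  have "homog j (S n ^ p)"
    using homog_cong[OF homog_power[OF homog_S]] p j by simp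
  then have "e (V ^ p) * U ^ n \<simeq> e (U ^ j) * (U ^ (n - j) * S n ^ p)"
    using Upow_S_power[of 0 p n] by (intro key) simp_all
  also have "\<dots> \<simeq> e (U ^ j) * (S j ^ p * U ^ (n - j))"
    by (intro eqv_lmult, rule eqv_sym) (use Upow_S_power[of j p "n - j"] j in simp)
  \<comment> \<open>Cancelling \<open>U ^ (n - j)\<close> makes \<open>e (U ^ j) * S j ^ p\<close> a
    left multiple of \<open>U ^ j\<close>, as \<open>eqv_mult_U_power\<close> requires.\<close>
  finally have "e (V ^ p) * U ^ j * U ^ (n - j) \<simeq> e (U ^ j) * S j ^ p * U ^ (n - j)"
    by (simp add: Un_split mult.assoc)
  then have "e (U ^ j) * S j ^ p \<simeq> e (V ^ p) * U ^ j"
    by (rule eqv_sym[OF U_power_cancel])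
  then obtain c where c: "e (U ^ j) \<simeq> c * U ^ j" using eqv_mult_U_power by blast
  \<comment> \<open>The multiplier found for \<open>U ^ j\<close> serves every word of this weight,
    since \<open>key\<close> expresses \<open>e\<close> there through
    \<open>e (U ^ j)\<close>.\<close>
  have "e (mon w d) \<simeq> c * mon w d" if "weight a w mod n = j" for w d
  proof -
    obtain s where s: "homog (weight a w) s" "mon w d * U ^ n \<simeq> U ^ n * s"
      using mon_U_power by blast
    then have "homog j s" using homog_cong that j by simp
    then have "e (mon w d) * U ^ n \<simeq> e (U ^ j) * (U ^ (n - j) * s)" using s key by blast
    also have "\<dots> \<simeq> c * U ^ j * (U ^ (n - j) * s)" by (intro eqv_rmult c)
    also have "\<dots> = c * (U ^ n * s)" by (simp add: Un_split mult.assoc)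
    also have "\<dots> \<simeq> c * (mon w d * U ^ n)" by (intro eqv_lmult eqv_sym[OF s(2)])
    finally have "e (mon w d) * U ^ n \<simeq> c * mon w d * U ^ n" by (simp add: mult.assoc)
    then show ?thesis by (rule U_power_cancel)
  qed
  then show ?thesis by blast
qed

lemma auslanderf_surjective:
  assumes "endo e"
  shows "\<exists>x. \<forall>f. auslanderf x f \<simeq> e f"
proof -
  obtain c where c: "\<And>j w d. j < n \<Longrightarrow> weight a w mod n = j \<Longrightarrow> e (mon w d) \<simeq> c j * mon w d"
    using endo_homog[OF assms] by metis
  \<comment> \<open>Inverse Fourier transform of \<open>c\<close>, so that the Fourier coefficient
    of \<open>x\<close> at \<open>j\<close> is \<open>c j\<close>.\<close>
  define x where "x k = (\<Sum>j<n. cst (inverse (of_nat n) * \<omega> ^ (k * (n - j))) * c j)" for k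
  have "auslanderf x f \<simeq> e f" for f
  proof (induction f rule: free_alg_induct)
    case (mon w d)
    define i where "i = weight a w mod n"
    have i: "i < n" using n_pos by (simp add: i_def)
    have "(\<Sum>k<n. cst (\<omega> ^ (k * i)) * x k)
        = (\<Sum>j<n. \<Sum>k<n. cst (inverse (of_nat n) * \<omega> ^ (k * (i + (n - j)))) * c j)"
      unfolding x_def sum_distrib_left
      by (subst sum.swap) (intro sum.cong refl, simp add: cst_cst power_add distrib_left mult_ac del: add_diff_assoc)
    also have "\<dots> = (\<Sum>j<n. cst (inverse (of_nat n) * (\<Sum>k<n. \<omega> ^ (k * (i + (n - j))))) * c j)"
      by (simp add: sum_distrib_left sum_distrib_right cst_sum)
    also have "\<dots> = (\<Sum>j<n. if j = i then c j else 0)"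
      using i n_pos by (intro sum.cong refl) (auto simp: omega_sum dvd_shift_iff simp del: add_diff_assoc)
    also have "\<dots> = c i" using i by simp
    finally have "auslanderf x (mon w d) = c i * mon w d"
      using auslanderf_homog[OF homog_cong[OF homog_mon, of w i], of x d] by (simp add: i_def)
    then show ?case using eqv_sym[OF c[OF i i_def[symmetric], of d]] by simp
  next
    case (add f g)
    have "auslanderf x (f + g) = auslanderf x f + auslanderf x g"
      by (simp add: auslanderf_def actf_add distrib_left sum.distrib)
    also have "\<dots> \<simeq> e f + e g" by (intro eqv_add add)
    also have "\<dots> \<simeq> e (f + g)" by (rule eqv_sym) (use assms in \<open>simp add: endo_def\<close>)
    finally show ?case .
  qed
  then show ?thesis by blast
qed

section \<open>Transfer to coefficient functions\<close>

text \<open>A family \<open>x\<close> encodes the element \<open>\<Sum>\<^sub>k x\<^sub>k g\<^sup>k\<close>; its values at \<open>k \<ge> n\<close> are ignored.\<close>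

definition skew :: "(nat \<Rightarrow> 'k free_alg) \<Rightarrow> nat \<times> word \<Rightarrow> 'k" where
  "skew x = (\<lambda>(k, w). if k < n then lk (x k) w else 0)"

lemma skew_cong: "(\<And>k. k < n \<Longrightarrow> x k = y k) \<Longrightarrow> skew x = skew y"
  by (auto simp: skew_def fun_eq_iff)

lemma skew_in_SG: "skew x \<in> SG n"
proof -
  have "{p. skew x p \<noteq> 0} \<subseteq> (\<Union>k<n. Pair k ` {w. lk (x k) w \<noteq> 0})"
    by (auto simp: skew_def split: if_splits)
  then have "finite {p. skew x p \<noteq> 0}" by (rule finite_subset) simp
  then show ?thesis by (auto simp: SG_def skew_def)
qed

lemma SG_E:
  assumes "y \<in> SG n"
  obtains x where "y = skew x"
proof -
  have fin: "finite {w. y (k, w) \<noteq> 0}" for k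
  proof -
    have "{w. y (k, w) \<noteq> 0} \<subseteq> snd ` {p. y p \<noteq> 0}" by force
    moreover have "finite {p. y p \<noteq> 0}" using assms by (simp add: SG_def)
    ultimately show ?thesis using finite_subset by blast
  qed
  have "y = skew (\<lambda>k. Abs_poly_mapping (\<lambda>w. y (k, w)))"
    using assms fin by (auto simp: skew_def fun_eq_iff SG_def)
  then show thesis by (rule that)
qed

lemma ball_SG_iff: "(\<forall>y\<in>SG n. P y) \<longleftrightarrow> (\<forall>x. P (skew x))"
  by (metis SG_E skew_in_SG)

lemma skew_add: "skew (\<lambda>k. x k + y k) = (\<lambda>p. skew x p + skew y p)"
  and skew_diff: "skew (\<lambda>k. x k - y k) = (\<lambda>p. skew x p - skew y p)"
  and skew_scale: "skew (\<lambda>k. cst c * x k) = (\<lambda>p. c * skew x p)"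
  by (auto simp: skew_def fun_eq_iff lookup_add lookup_minus lk_cst_mult)

lemma sg_mult_skew: "sg_mult n \<omega> a (skew x) (skew y) = skew (skew_mult x y)"
proof -
  have "sg_mult n \<omega> a (skew x) (skew y) (k, w) = skew (skew_mult x y) (k, w)" for k w
  proof (cases "k < n")
    case True
    then show ?thesis
      by (simp add: sg_mult_def skew_def skew_mult_def lookup_sum lk_mult fa_mult_def lk_actf act_def
            mult.assoc if_distrib[of "\<lambda>f. lk f w"] cong: if_cong)
  next
    case False
    then have "(k1 + k2) mod n \<noteq> k" for k1 k2 using n_pos mod_less_divisor by metis
    then show ?thesis using False by (simp add: sg_mult_def skew_def)
  qed
  then show ?thesis by (simp add: fun_eq_iff)
qed

lemma skew_in_skew_ker_iff: "skew x \<in> skew_ker n (lk rl) \<longleftrightarrow> (\<forall>k<n. x k \<simeq> 0)"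
proof -
  have "(\<lambda>w. skew x (k, w)) = (if k < n then lk (x k) else lk 0)" for k
    by (auto simp: skew_def fun_eq_iff)
  then show ?thesis by (auto simp: skew_ker_def skew_in_SG eqv_0_iff)
qed

lemma auslander_skew: "auslander n \<omega> a (skew x) (lk f) = lk (auslanderf x f)"
  by (simp add: fun_eq_iff auslander_def auslanderf_def skew_def lookup_sum lk_mult fa_mult_def
      lk_actf act_def mult.assoc)

lemma lk_diff_eqv: "(\<lambda>w. lk f w - lk g w) \<in> I_rel (lk rl) \<longleftrightarrow> f \<simeq> g"
proof -
  have "(\<lambda>w. lk f w - lk g w) = lk (f - g)" by (simp add: lookup_minus fun_eq_iff)
  then show ?thesis by (simp add: eqv_def)
qed

lemma lk_diff_diff_eqv: "(\<lambda>w. lk f w - lk g w - lk h w) \<in> I_rel (lk rl) \<longleftrightarrow> f \<simeq> g + h"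
proof -
  have "(\<lambda>w. lk f w - lk g w - lk h w) = (\<lambda>w. lk f w - lk (g + h) w)"
    by (simp add: lookup_add fun_eq_iff algebra_simps)
  then show ?thesis by (simp add: lk_diff_eqv)
qed

lemma ball_inv_ring_iff:
  "(\<forall>c\<in>inv_ring n \<omega> a (lk rl). P c) \<longleftrightarrow> (\<forall>f. (\<forall>k<n. actf k f \<simeq> f) \<longrightarrow> P (lk f))"
  by (auto simp: inv_ring_def lk_diff_eqv simp flip: lk_actf elim!: FA_E)

lemma is_End_iff:
  assumes "\<And>f. E (lk f) = lk (e f)"
  shows "is_End n \<omega> a (lk rl) E \<longleftrightarrow> endo e"
  unfolding is_End_def endo_def ball_FA_iff ball_inv_ring_iff
  by (simp add: assms lk_diff_eqv lk_diff_diff_eqv flip: lookup_add lk_mult)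

text \<open>\<open>E\<close> maps \<open>FA\<close> into \<open>FA\<close>, so representatives of
  its values can be chosen.\<close>

lemma is_End_E:
  assumes "is_End n \<omega> a (lk rl) E"
  obtains e where "\<And>f. E (lk f) = lk (e f)" "endo e"
proof -
  have "\<exists>g. E (lk f) = lk g" for f
  proof -
    have "E (lk f) \<in> FA" using assms by (simp add: is_End_def)
    then show ?thesis by (auto elim: FA_E)
  qed
  then obtain e where "\<And>f. E (lk f) = lk (e f)" by metis
  then show thesis using assms is_End_iff that by blast
qed

lemma sg_one_eq: "sg_one = skew (\<lambda>k. if k = 0 then 1 else 0)"
  using n_pos by (auto simp: sg_one_def skew_def fun_eq_iff lookup_one zero_list_def)

lemma auslander_iso_rl: "auslander_iso n \<omega> a (lk rl)"
  unfolding auslander_iso_def ball_SG_iff ball_FA_iff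
proof (intro conjI allI impI)
  fix x :: "nat \<Rightarrow> 'k free_alg"
  show "is_End n \<omega> a (lk rl) (auslander n \<omega> a (skew x))"
    using is_End_iff[of "auslander n \<omega> a (skew x)" "auslanderf x", OF auslander_skew] auslanderf_endo by blast
next
  fix x y :: "nat \<Rightarrow> 'k free_alg" and f
  assume "(\<lambda>p. skew x p - skew y p) \<in> skew_ker n (lk rl)"
  then have "\<forall>k<n. x k - y k \<simeq> 0" by (simp add: skew_in_skew_ker_iff flip: skew_diff)
  then show "(\<lambda>w. auslander n \<omega> a (skew x) (lk f) w - auslander n \<omega> a (skew y) (lk f) w) \<in> I_rel (lk rl)"
    unfolding auslander_skew lk_diff_eqv auslanderf_def
    by (intro eqv_sum eqv_rmult) (simp add: eqv_def)
next
  fix f :: "'k free_alg"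
  have "auslanderf (\<lambda>k. if k = 0 then 1 else 0) f = (\<Sum>k<n. if k = 0 then f else 0)"
    unfolding auslanderf_def by (intro sum.cong) auto
  then show "(\<lambda>w. auslander n \<omega> a sg_one (lk f) w - lk f w) \<in> I_rel (lk rl)"
    unfolding sg_one_eq auslander_skew lk_diff_eqv using n_pos by simp
next
  fix x y :: "nat \<Rightarrow> 'k free_alg" and f
  show "(\<lambda>w. auslander n \<omega> a (sg_mult n \<omega> a (skew x) (skew y)) (lk f) w
      - auslander n \<omega> a (skew x) (auslander n \<omega> a (skew y) (lk f)) w) \<in> I_rel (lk rl)"
    unfolding sg_mult_skew auslander_skew lk_diff_eqv auslanderf_skew_mult by (rule eqv_refl)
next
  fix x :: "nat \<Rightarrow> 'k free_alg"
  assume "\<forall>f. auslander n \<omega> a (skew x) (lk f) \<in> I_rel (lk rl)"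
  then show "skew x \<in> skew_ker n (lk rl)"
    using auslanderf_injective[of x] by (simp add: auslander_skew skew_in_skew_ker_iff eqv_0_iff)
next
  fix E assume "is_End n \<omega> a (lk rl) E"
  then obtain e where e: "\<And>f. E (lk f) = lk (e f)" "endo e" by (rule is_End_E) blast
  then obtain x where "\<forall>f. auslanderf x f \<simeq> e f" using auslanderf_surjective by blast
  then have "\<forall>f. (\<lambda>w. auslander n \<omega> a (skew x) (lk f) w - E (lk f) w) \<in> I_rel (lk rl)"
    by (simp add: e auslander_skew lk_diff_eqv)
  then show "\<exists>y\<in>SG n. \<forall>f. (\<lambda>w. auslander n \<omega> a y (lk f) w - E (lk f) w) \<in> I_rel (lk rl)"
    using skew_in_SG by blast
qed

subsection \<open>The ideal generated by the group sum\<close>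

definition J :: "(nat \<Rightarrow> 'k free_alg) set" where
  "J = {x. skew x \<in> gbar_ideal n \<omega> a (lk rl)}"

text \<open>The element f g^l of the skew group algebra.\<close>

definition delta :: "'k free_alg \<Rightarrow> nat \<Rightarrow> nat \<Rightarrow> 'k free_alg" where
  "delta f l = (\<lambda>k. if k = l then f else 0)"

lemma J_cong: "x \<in> J \<Longrightarrow> (\<And>k. k < n \<Longrightarrow> x k = y k) \<Longrightarrow> y \<in> J"
  using skew_cong[of x y] by (simp add: J_def)

lemma J_add: "x \<in> J \<Longrightarrow> y \<in> J \<Longrightarrow> (\<lambda>k. x k + y k) \<in> J"
  unfolding J_def mem_Collect_eq skew_add gbar_ideal_def by (rule ideal_gen.add)

lemma J_0: "(\<lambda>_. 0) \<in> J"
proof -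
  have "skew (\<lambda>_. 0) = (\<lambda>_. 0)" by (auto simp: skew_def fun_eq_iff)
  then show ?thesis by (simp add: J_def gbar_ideal_def ideal_gen.zero)
qed

lemma J_sum: "(\<And>i. i \<in> A \<Longrightarrow> x i \<in> J) \<Longrightarrow> (\<lambda>k. \<Sum>i\<in>A. x i k) \<in> J"
  by (induction A rule: infinite_finite_induct) (simp_all add: J_0 J_add)

lemma J_skew_mult_left: "x \<in> J \<Longrightarrow> skew_mult y x \<in> J"
  and J_skew_mult_right: "x \<in> J \<Longrightarrow> skew_mult x y \<in> J"
  unfolding J_def mem_Collect_eq gbar_ideal_def sg_mult_skew[symmetric]
  by (intro ideal_gen.lmult ideal_gen.rmult skew_in_SG; assumption)+

lemma skew_mult_delta_left:
  assumes "k < n" shows "skew_mult (delta f 0) x k = f * x k"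
proof -
  have "skew_mult (delta f 0) x k
      = (\<Sum>k1<n. if k1 = 0 then \<Sum>k2<n. if k2 = k then f * x k2 else 0 else 0)"
    unfolding skew_mult_def delta_def by (intro sum.cong refl) (auto intro!: sum.cong sum.neutral)
  also have "\<dots> = f * x k" using assms n_pos by (simp add: sum.delta)
  finally show ?thesis .
qed

lemma skew_mult_delta_right:
  assumes "k < n" shows "skew_mult x (delta g 0) k = x k * actf k g"
proof -
  have "skew_mult x (delta g 0) k
      = (\<Sum>k1<n. \<Sum>k2<n. if k2 = 0 then if k1 = k then x k1 * actf k1 g else 0 else 0)"
    unfolding skew_mult_def delta_def by (intro sum.cong refl) auto
  also have "\<dots> = x k * actf k g" using assms n_pos by (simp add: sum.delta)
  finally show ?thesis .
qed

lemma J_mult_left: "x \<in> J \<Longrightarrow> (\<lambda>k. f * x k) \<in> J"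
  by (rule J_cong[OF J_skew_mult_left[of x "delta f 0"]]) (simp_all add: skew_mult_delta_left)

lemma J_mult_right: "x \<in> J \<Longrightarrow> (\<lambda>k. x k * actf k g) \<in> J"
  by (rule J_cong[OF J_skew_mult_right[of x "delta g 0"]]) (simp_all add: skew_mult_delta_right)

lemma J_delta_left: "delta f l \<in> J \<Longrightarrow> delta (g * f) l \<in> J"
  by (drule J_mult_left[of _ g]) (simp add: delta_def if_distrib cong: if_cong)

text \<open>The identity component does not twist the right factor \<open>delta g l\<close>, which
  carries the element to component \<open>l\<close>.\<close>

lemma J_delta_right:
  assumes "delta f 0 \<in> J" shows "delta (f * g) l \<in> J"
proof (rule J_cong[OF J_skew_mult_right[OF assms, of "delta g l"]])
  show "skew_mult (delta f 0) (delta g l) k = delta (f * g) l k" if "k < n" for k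
    using that by (simp add: skew_mult_delta_left) (simp add: delta_def)
qed

lemma J_ideal: "f \<in> ideal_of rl \<Longrightarrow> delta f l \<in> J"
  unfolding J_def mem_Collect_eq gbar_ideal_def
  by (intro ideal_gen.gen UnI1) (simp add: skew_in_skew_ker_iff delta_def eqv_0_iff)

lemma J_one: "(\<lambda>_. 1) \<in> J"
proof -
  have "skew (\<lambda>_. 1) = gbar n"
    by (auto simp: skew_def gbar_def fun_eq_iff lookup_one zero_list_def)
  then show ?thesis by (simp add: J_def gbar_ideal_def ideal_gen.gen)
qed

text \<open>The component of \<open>z ^ (n - j) * gbar * z ^ j\<close> at \<open>k\<close> is
  \<open>\<omega> ^ (j * (k * i)) * z ^ n\<close>. As \<open>i\<close> is coprime to
  \<open>n\<close>, summing over \<open>j\<close> kills every component except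
  \<open>k = 0\<close>.\<close>

lemma J_power:
  assumes "homog i z" "coprime i n"
  shows "delta (z ^ n) 0 \<in> J"
proof -
  have "(\<lambda>k. cst (\<omega> ^ (j * (k * i))) * z ^ n) \<in> J" if j: "j < n" for j
  proof -
    have "homog (i * j) (z ^ j)" by (intro homog_power assms)
    then have "z ^ (n - j) * 1 * actf k (z ^ j) = cst (\<omega> ^ (j * (k * i))) * z ^ n" for k
      using j by (simp add: homog_def cst_left_commute[of "z ^ _"] mult_ac flip: power_add)
    then show ?thesis
      using J_mult_right[OF J_mult_left[OF J_one, of "z ^ (n - j)"], of "z ^ j"] by simp
  qed
  from J_mult_left[OF J_sum[of "{..<n}", OF this], where f = "cst (inverse (of_nat n))"]
  show ?thesis
  proof (rule J_cong)
    fix k assume k: "k < n"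
    have "(\<Sum>j<n. cst (\<omega> ^ (j * (k * i))) * z ^ n) = cst (\<Sum>j<n. \<omega> ^ (j * (k * i))) * z ^ n"
      by (simp add: cst_sum sum_distrib_right)
    moreover have "n dvd k * i \<longleftrightarrow> k = 0"
      using k assms(2) by (auto simp: coprime_dvd_mult_left_iff coprime_commute dest: dvd_imp_le)
    ultimately show "cst (inverse (of_nat n)) * (\<Sum>j<n. cst (\<omega> ^ (j * (k * i))) * z ^ n) = delta (z ^ n) 0 k"
      using n_pos by (auto simp: omega_sum delta_def cst_cst)
  qed auto
qed

lemma J_normal:
  assumes "n \<le> j \<or> n \<le> i" shows "delta (V ^ j * U ^ i) l \<in> J"
  using assms
proof
  assume "n \<le> j"
  then have "(V ^ j * U ^ i :: 'k free_alg) = V ^ n * (V ^ (j - n) * U ^ i)" by (simp flip: mult.assoc power_add)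
  then show ?thesis using J_delta_right[OF J_power[OF homog_V coprime_a], of "V ^ (j - n) * U ^ i" l] by (simp only:)
next
  assume "n \<le> i"
  \<comment> \<open>The factor 1 allows \<open>J_delta_right\<close> to move the element from
    component 0 to \<open>l\<close>.\<close>
  then have "(V ^ j * U ^ i :: 'k free_alg) = V ^ j * U ^ (i - n) * U ^ n * 1" by (simp add: mult.assoc flip: power_add)
  moreover have "delta (V ^ j * U ^ (i - n) * U ^ n) 0 \<in> J"
    by (intro J_delta_left J_power[OF homog_U]) simp
  ultimately show ?thesis using J_delta_right by metis
qed

lemma fin_dim_quot_rl: "fin_dim_quot (SG n) (gbar_ideal n \<omega> a (lk rl))"
proof -
  define B where "B = (\<lambda>(j, i, l). skew (delta (V ^ j * U ^ i) l)) ` ({..<n} \<times> {..<n} \<times> {..<n})"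
  have B: "finite B" "B \<subseteq> SG n" by (auto simp: B_def skew_in_SG)
  \<comment> \<open>Membership in the span of \<open>B\<close> plus the ideal. It is linear in
    \<open>x\<close>, so each component can be treated by \<open>normal_induct\<close>.\<close>
  define W where "W x \<longleftrightarrow> (\<exists>c. (\<lambda>p. skew x p - (\<Sum>b\<in>B. c b * b p)) \<in> gbar_ideal n \<omega> a (lk rl))" for x
  have W_J: "W x" if "x \<in> J" for x
    using that unfolding W_def J_def by (intro exI[of _ "\<lambda>_. 0"]) simp
  have W_B: "W x" if "skew x \<in> B" for x
  proof -
    \<comment> \<open>Coefficients are indexed by the elements of \<open>B\<close>, so coinciding
      generators cause no trouble.\<close>
    have "(\<Sum>b\<in>B. (if b = skew x then 1 else 0) * b p) = skew x p" for p
      using B(1) that by (simp add: if_distrib[of "\<lambda>c. c * _"] cong: if_cong)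
    then show ?thesis
      unfolding W_def gbar_ideal_def
      by (intro exI[of _ "\<lambda>b. if b = skew x then 1 else 0"]) (simp add: ideal_gen.zero)
  qed
  have W_add: "W (\<lambda>k. x k + y k)" if "W x" "W y" for x y
  proof -
    obtain c d where
      "(\<lambda>p. skew x p - (\<Sum>b\<in>B. c b * b p)) \<in> gbar_ideal n \<omega> a (lk rl)"
      "(\<lambda>p. skew y p - (\<Sum>b\<in>B. d b * b p)) \<in> gbar_ideal n \<omega> a (lk rl)"
      using \<open>W x\<close> \<open>W y\<close> unfolding W_def by blast
    from ideal_gen.add[OF this[unfolded gbar_ideal_def]] show ?thesis
      unfolding W_def gbar_ideal_def
      by (intro exI[of _ "\<lambda>b. c b + d b"]) (simp add: skew_add distrib_right sum.distrib algebra_simps)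
  qed
  have W_scale: "W (\<lambda>k. cst r * x k)" if "W x" for r x
  proof -
    obtain c where "(\<lambda>p. skew x p - (\<Sum>b\<in>B. c b * b p)) \<in> gbar_ideal n \<omega> a (lk rl)"
      using \<open>W x\<close> unfolding W_def by blast
    from ideal_gen.smult[OF this[unfolded gbar_ideal_def], of r] show ?thesis
      unfolding W_def gbar_ideal_def
      by (intro exI[of _ "\<lambda>b. r * c b"]) (simp add: skew_scale right_diff_distrib sum_distrib_left mult.assoc)
  qed
  have W_delta: "W (delta f l)" if "l < n" for f l
  proof (induction f rule: normal_induct)
    case (ideal f)
    then show ?case by (intro W_J J_ideal)
  next
    case (normal j i)
    show ?case
    proof (cases "j < n \<and> i < n")
      case True
      then show ?thesis using that by (intro W_B, unfold B_def, intro image_eqI[of _ _ "(j, i, l)"]) auto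
    next
      case False
      then show ?thesis by (intro W_J J_normal) auto
    qed
  next
    case (add f g)
    from W_add[OF add(3,4)] show ?case by (simp add: delta_def if_distrib cong: if_cong)
  next
    case (scale f c)
    from W_scale[OF scale(2), of c] show ?case by (simp add: delta_def if_distrib cong: if_cong)
  qed
  have W_sum: "W (\<lambda>k. \<Sum>l\<in>A. delta (x l) l k)" if "A \<subseteq> {..<n}" for x A
    using finite_subset[OF that finite_lessThan] that
    by (induction A rule: finite_induct) (simp_all add: W_J J_0 W_add W_delta)
  have "W x" for x
  proof -
    have "skew (\<lambda>k. \<Sum>l<n. delta (x l) l k) = skew x"
      by (intro skew_cong) (simp add: delta_def)
    then show ?thesis using W_sum[of "{..<n}" x] by (simp add: W_def)
  qed
  then show ?thesis
    unfolding fin_dim_quot_def ball_SG_iff W_def using B by blast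
qed

end

theorem mainTheorem3:
  fixes q \<omega> :: "'k::field_char_0" and n a :: nat and rel :: "word \<Rightarrow> 'k"
  assumes "algebraically_closed_field TYPE('k)"
    and "\<omega> ^ n = 1" and "\<forall>m. 0 < m \<and> m < n \<longrightarrow> \<omega> ^ m \<noteq> 1"
    and "(rel = qrel q \<and> q \<noteq> 0 \<and> q \<noteq> 1 \<and> 1 \<le> a \<and> a < n \<and> coprime a n)
         \<or> (rel = jrel \<and> a = 1 \<and> n \<ge> 2)"
  shows "fin_dim_quot (SG n) (gbar_ideal n \<omega> a rel) \<and> auslander_iso n \<omega> a rel"
  using assms(4)
proof
  assume *: "rel = qrel q \<and> q \<noteq> 0 \<and> q \<noteq> 1 \<and> 1 \<le> a \<and> a < n \<and> coprime a n"
  \<comment> \<open>The quantum plane is the case \<open>lam = 0\<close>.\<close>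
  then interpret quantum_plane_cyclic q 0 \<omega> n a
    using assms(2,3) by unfold_locales auto
  have "lk rl = rel"
    using * by (auto simp: rl_def U_def V_def cst_def mon_mult lookup_minus lookup_single qrel_def fun_eq_iff simp del: mon_Nil)
  then show ?thesis using fin_dim_quot_rl auslander_iso_rl by simp
next
  assume *: "rel = jrel \<and> a = 1 \<and> n \<ge> 2"
  \<comment> \<open>The Jordan plane is the case \<open>q = lam = 1\<close>; the weight
    \<open>a = 1\<close> is coprime to every \<open>n\<close>.\<close>
  then interpret quantum_plane_cyclic 1 1 \<omega> n a
    using assms(2,3) by unfold_locales auto
  have "lk rl = rel"
    using * by (auto simp: rl_def U_def V_def cst_def mon_mult lookup_minus lookup_single jrel_def fun_eq_iff simp del: mon_Nil)
  then show ?thesis using fin_dim_quot_rl auslander_iso_rl by simp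
qed

end
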